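(* Under homogeneous Dirichlet or periodic boundary conditions, and in the absence of external force ($\bm f=\bm 0$), the following BDF2 scheme preserves a discrete energy dissipation law. Scheme: given $\bm u^0$, and $\bm u^1$ obtained from the BDF1 scheme, for $1\le n\le N_t-1$ the pair $(\bm u^{n+1},p^{n+1})$ satisfies $$\frac{3\bm u^{n+1}-4\bm u^n+\bm u^{n-1}}{2\tau}-\nu\Delta\bm u^{n+1}+\bm B(\overline{\bm u}^{n+1},\bm u^{n+1})+\nabla p^{n+1}=\bm f^{n+1},\qquad \nabla\cdot\bm u^{n+1}=0,$$ where $\overline{\bm u}^{n+1}=2\bm u^n-\bm u^{n-1}$. Energy law: for $1\le n\le N_t-1$, $$\frac{\widehat E^{n+1}-\widehat E^n}{\tau}=-\nu\|\nabla\bm u^{n+1}\|^2-\frac1{4\tau}\|\bm u^{n+1}-2\bm u^n+\bm u^{n-1}\|^2,$$ where $$\widehat E^n=\frac14\Big(\|\bm u^n\|^2+\|2\bm u^n-\bm u^{n-1}\|^2\Big).$$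
   Context: $\Omega\subset\mathbb R^d$ ($d=2,3$) is a rectangular domain, $\nu>0$, $T>0$, $N_t$ is a positive integer, $\tau=T/N_t$, $t_n=n\tau$; $\bm f^{n+1}$ is the external force at time $t_{n+1}$. $(\cdot,\cdot)$ and $\|\cdot\|$ denote the $L^2(\Omega)$ inner product and norm (for vector and matrix fields, summed over components). The $\bm u^n$ are $\mathbb R^d$-valued velocity fields on $\Omega$ and $p^{n+1}$ are scalar pressures. The computed velocities $\bm u^{n+1}$ satisfy either $\bm u^{n+1}=\bm 0$ on $\partial\Omega$ (homogeneous Dirichlet), or periodicity (then pressures are periodic too). All fields are smooth enough for the expressions to make sense. $(\bm u\cdot\nabla\bm u)_i=\sum_j u_j\partial_j u_i$. $\bm F$ is a user-specified map taking a vector field $\bm u$ on $\Omega$ to a vector field $\bm F(\bm u)$ on $\Omega$ and satisfying the non-degeneracy condition $(\bm F(\bm u),\bm u)\neq 0$ whenever $\|\bm u\|\neq 0$. Define $$\bm G(\bm u)=\frac{\bm u\cdot\nabla\bm u}{(\bm F(\bm u),\bm u)}\ \text{ if }\|\bm u\|\ne0,\qquad \bm G(\bm u)=\bm 0\ \text{ otherwise},$$ $$\bm B(\bm u,\bm v)=\big(\bm F(\bm u),\bm v\big)\bm G(\bm u)-\big(\bm G(\bm u),\bm v\big)\bm F(\bm u).$$ BDF1 scheme (used only for the starting value $\bm u^1$): $\frac{\bm u^{1}-\bm u^0}{\tau}-\nu\Delta\bm u^{1}+\bm B(\bm u^0,\bm u^{1})+\nabla p^{1}=\bm f^{1}$,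 $\nabla\cdot\bm u^{1}=0$, with the same boundary conditions. *)

theory Defs
  imports "HOL-Analysis.Analysis"
begin

section \<open>Differential operators\<close>

definition pd :: "'d::finite \<Rightarrow> (real^'d \<Rightarrow> 'b::real_normed_vector) \<Rightarrow> real^'d \<Rightarrow> 'b" where
  "pd j f x = frechet_derivative f (at x) (axis j 1)"

definition grad :: "(real^'d::finite \<Rightarrow> real) \<Rightarrow> real^'d \<Rightarrow> real^'d" where
  "grad q x = (\<chi> j. pd j q x)"

definition vgrad :: "(real^'d::finite \<Rightarrow> real^'d) \<Rightarrow> real^'d \<Rightarrow> real^'d^'d" where
  "vgrad v x = (\<chi> i j. pd j v x $ i)"

definition divergence :: "(real^'d::finite \<Rightarrow> real^'d) \<Rightarrow> real^'d \<Rightarrow> real" where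
  "divergence v x = (\<Sum>j\<in>UNIV. pd j v x $ j)"

definition laplacian :: "(real^'d::finite \<Rightarrow> real^'d) \<Rightarrow> real^'d \<Rightarrow> real^'d" where
  "laplacian v x = (\<Sum>j\<in>UNIV. pd j (pd j v) x)"

definition convection :: "(real^'d::finite \<Rightarrow> real^'d) \<Rightarrow> real^'d \<Rightarrow> real^'d" where
  "convection v x = (\<Sum>j\<in>UNIV. (v x $ j) *\<^sub>R pd j v x)"


section \<open>The space L2 over a domain\<close>

text \<open>On matrix fields the inner product of \<^typ>\<open>real^'d^'d\<close> is the entrywise (Frobenius) one,
  so these definitions cover scalar, vector and matrix fields alike.\<close>

definition L2_inner :: "(real^'d::finite) set \<Rightarrow> (real^'d \<Rightarrow> 'b::euclidean_space) \<Rightarrow> (real^'d \<Rightarrow> 'b) \<Rightarrow> real" where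
  "L2_inner \<Omega> v w = (LINT x:\<Omega>|lebesgue. v x \<bullet> w x)"

definition L2_norm :: "(real^'d::finite) set \<Rightarrow> (real^'d \<Rightarrow> 'b::euclidean_space) \<Rightarrow> real" where
  "L2_norm \<Omega> v = sqrt (L2_inner \<Omega> v v)"

definition in_L2 :: "(real^'d::finite) set \<Rightarrow> (real^'d \<Rightarrow> 'b::euclidean_space) \<Rightarrow> bool" where
  "in_L2 \<Omega> v \<longleftrightarrow> set_borel_measurable lebesgue \<Omega> v \<and> set_integrable lebesgue \<Omega> (\<lambda>x. v x \<bullet> v x)"


section \<open>Regularity and boundary conditions\<close>

text \<open>For open \<open>\<Omega>\<close>, \<open>Ck_closed k \<Omega> f\<close> is the usual class of functions that are \<open>k\<close> times
  continuously differentiable in \<open>\<Omega>\<close> and whose partial derivatives up to order \<open>k\<close> extend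
  continuously to the closure of \<open>\<Omega>\<close>. It says nothing about the values of \<open>f\<close> off \<open>\<Omega>\<close>.
  With \<open>\<Omega> = UNIV\<close> it is plain k-fold continuous differentiability on the whole space.\<close>

primrec Ck_closed :: "nat \<Rightarrow> (real^'d::finite) set \<Rightarrow> (real^'d \<Rightarrow> 'b::real_normed_vector) \<Rightarrow> bool" where
  "Ck_closed 0 \<Omega> f \<longleftrightarrow> (\<exists>g. continuous_on (closure \<Omega>) g \<and> (\<forall>x\<in>\<Omega>. g x = f x))"
| "Ck_closed (Suc k) \<Omega> f \<longleftrightarrow>
     (\<exists>g. continuous_on (closure \<Omega>) g \<and> (\<forall>x\<in>\<Omega>. g x = f x)) \<and>
     f differentiable_on \<Omega> \<and> (\<forall>j. Ck_closed k \<Omega> (pd j f))"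

text \<open>Continuity up to the boundary makes the pointwise values of \<open>v\<close> on the boundary its
  boundary values as a field on \<open>\<Omega>\<close>.\<close>

definition homogeneous_dirichlet :: "(real^'d::finite) set \<Rightarrow> (real^'d \<Rightarrow> real^'d) \<Rightarrow> bool" where
  "homogeneous_dirichlet \<Omega> v \<longleftrightarrow> continuous_on (closure \<Omega>) v \<and> (\<forall>x\<in>frontier \<Omega>. v x = 0)"

definition periodic :: "real^'d::finite \<Rightarrow> real^'d \<Rightarrow> (real^'d \<Rightarrow> 'b) \<Rightarrow> bool" where
  "periodic a b f \<longleftrightarrow> (\<forall>x j. f (x + axis j (b $ j - a $ j)) = f x)"

definition dirichlet_solution_space ::
  "real^'d::finite \<Rightarrow> real^'d \<Rightarrow> (real^'d \<Rightarrow> real^'d) \<Rightarrow> (real^'d \<Rightarrow> real) \<Rightarrow> bool" where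
  "dirichlet_solution_space a b v q \<longleftrightarrow>
     Ck_closed 2 (box a b) v \<and> Ck_closed 1 (box a b) q \<and> homogeneous_dirichlet (box a b) v"

text \<open>A smooth periodic field on the box is a smooth field on the whole space that is periodic
  with the side lengths of the box as periods.\<close>

definition periodic_solution_space ::
  "real^'d::finite \<Rightarrow> real^'d \<Rightarrow> (real^'d \<Rightarrow> real^'d) \<Rightarrow> (real^'d \<Rightarrow> real) \<Rightarrow> bool" where
  "periodic_solution_space a b v q \<longleftrightarrow>
     Ck_closed 2 UNIV v \<and> Ck_closed 1 UNIV q \<and> periodic a b v \<and> periodic a b q"


section \<open>The nonlinear term\<close>

text \<open>Fields on \<open>\<Omega>\<close> are represented by total functions whose values off \<open>\<Omega>\<close> are irrelevant.
  \<open>F\<close> is not required to respect equality on \<open>\<Omega>\<close>, so every map between fields on \<open>\<Omega>\<close> is covered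
  (precompose with restriction to \<open>\<Omega>\<close>).\<close>

definition admissible_map ::
  "(real^'d::finite) set \<Rightarrow> ((real^'d \<Rightarrow> real^'d) \<Rightarrow> (real^'d \<Rightarrow> real^'d)) \<Rightarrow> bool" where
  "admissible_map \<Omega> F \<longleftrightarrow>
     (\<forall>v. Ck_closed 2 \<Omega> v \<longrightarrow>
        in_L2 \<Omega> (F v) \<and> (L2_norm \<Omega> v \<noteq> 0 \<longrightarrow> L2_inner \<Omega> (F v) v \<noteq> 0))"

definition G_map ::
  "(real^'d::finite) set \<Rightarrow> ((real^'d \<Rightarrow> real^'d) \<Rightarrow> (real^'d \<Rightarrow> real^'d)) \<Rightarrow>
   (real^'d \<Rightarrow> real^'d) \<Rightarrow> (real^'d \<Rightarrow> real^'d)" where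
  "G_map \<Omega> F v = (if L2_norm \<Omega> v \<noteq> 0
     then (\<lambda>x. (1 / L2_inner \<Omega> (F v) v) *\<^sub>R convection v x)
     else (\<lambda>x. 0))"

definition B_map ::
  "(real^'d::finite) set \<Rightarrow> ((real^'d \<Rightarrow> real^'d) \<Rightarrow> (real^'d \<Rightarrow> real^'d)) \<Rightarrow>
   (real^'d \<Rightarrow> real^'d) \<Rightarrow> (real^'d \<Rightarrow> real^'d) \<Rightarrow> (real^'d \<Rightarrow> real^'d)" where
  "B_map \<Omega> F v w = (\<lambda>x.
     L2_inner \<Omega> (F v) w *\<^sub>R G_map \<Omega> F v x - L2_inner \<Omega> (G_map \<Omega> F v) w *\<^sub>R F v x)"


section \<open>The time-stepping schemes\<close>

definition bdf1_step ::
  "(real^'d::finite) set \<Rightarrow> real \<Rightarrow> real \<Rightarrow> ((real^'d \<Rightarrow> real^'d) \<Rightarrow> (real^'d \<Rightarrow> real^'d)) \<Rightarrow>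
   (real^'d \<Rightarrow> real^'d) \<Rightarrow> (real^'d \<Rightarrow> real^'d) \<Rightarrow> (real^'d \<Rightarrow> real^'d) \<Rightarrow> (real^'d \<Rightarrow> real) \<Rightarrow> bool" where
  "bdf1_step \<Omega> \<nu> \<tau> F force u0 u1 p1 \<longleftrightarrow>
     (\<forall>x\<in>\<Omega>. (1 / \<tau>) *\<^sub>R (u1 x - u0 x) - \<nu> *\<^sub>R laplacian u1 x + B_map \<Omega> F u0 u1 x + grad p1 x
              = force x) \<and>
     (\<forall>x\<in>\<Omega>. divergence u1 x = 0)"

definition bdf2_step ::
  "(real^'d::finite) set \<Rightarrow> real \<Rightarrow> real \<Rightarrow> ((real^'d \<Rightarrow> real^'d) \<Rightarrow> (real^'d \<Rightarrow> real^'d)) \<Rightarrow>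
   (real^'d \<Rightarrow> real^'d) \<Rightarrow> (real^'d \<Rightarrow> real^'d) \<Rightarrow> (real^'d \<Rightarrow> real^'d) \<Rightarrow> (real^'d \<Rightarrow> real^'d) \<Rightarrow>
   (real^'d \<Rightarrow> real) \<Rightarrow> bool" where
  "bdf2_step \<Omega> \<nu> \<tau> F force u0 u1 u2 p2 \<longleftrightarrow>
     (\<forall>x\<in>\<Omega>. (1 / (2 * \<tau>)) *\<^sub>R (3 *\<^sub>R u2 x - 4 *\<^sub>R u1 x + u0 x) - \<nu> *\<^sub>R laplacian u2 x
              + B_map \<Omega> F (\<lambda>y. 2 *\<^sub>R u1 y - u0 y) u2 x + grad p2 x
              = force x) \<and>
     (\<forall>x\<in>\<Omega>. divergence u2 x = 0)"

text \<open>Only meaningful for \<open>n \<ge> 1\<close>.\<close>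

definition bdf2_energy :: "(real^'d::finite) set \<Rightarrow> (nat \<Rightarrow> real^'d \<Rightarrow> real^'d) \<Rightarrow> nat \<Rightarrow> real" where
  "bdf2_energy \<Omega> u n =
     1 / 4 * ((L2_norm \<Omega> (u n))\<^sup>2 + (L2_norm \<Omega> (\<lambda>x. 2 *\<^sub>R u n x - u (n - 1) x))\<^sup>2)"

end

theory Submission
  imports Defs
begin

text \<open>The energy law is the result of testing the momentum equation with the new velocity
  \<open>z = u (n + 1)\<close>. Write \<open>y = u n\<close> and \<open>x = u (n - 1)\<close>. Four things happen.

  The time difference contributes the energy increment and the numerical dissipation, pointwise and
  before any integration, because of the quadratic identity \<open>bdf2_polarization\<close>. The nonlinear
  term vanishes: \<open>B(v, z)\<close> is the antisymmetrised product
  \<open>(F v, z) G v - (G v, z) F v\<close>, so its inner product with \<open>z\<close> is zero for every \<open>F\<close>, as soon as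
  both \<open>F v \<bullet> z\<close> and \<open>G v \<bullet> z\<close> are integrable. The pressure term vanishes because \<open>z\<close> is
  divergence free, and the viscous term gives \<open>- \<nu> \<parallel>\<nabla>z\<parallel>\<^sup>2\<close>; both are integrations by parts
  whose boundary terms drop out.

  The analytic content is thus integration by parts on a box. A boundary term is the difference
  of the values of a product of two fields on opposite faces of the box. It is zero for
  homogeneous Dirichlet data, since one factor vanishes on every face, and for periodic data, since
  the product takes equal values on opposite faces. Both cases are covered by
  one predicate, \<open>face_products_match\<close>, and one argument: Fubini's theorem reduces
  the integral of a partial derivative to integrals along segments that join opposite faces,
  where the fundamental theorem of calculus applies
  (\<open>integral_directional_derivative_eq_0\<close>). In the Dirichlet case the fields are
  differentiable in the open box only, with
  derivatives that extend continuously to the closed box, so the fundamental theorem is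
  used in the form that asks for derivatives at interior points only.\<close>

section \<open>Integrals of derivatives over a box\<close>

text \<open>By Fubini, integrate first in the direction \<open>e\<close>. On every line parallel to \<open>e\<close> that meets the box the
  inner integral is the difference of the values of \<open>h\<close> at the two ends of the segment, and these
  values agree. The lines that miss the box contribute zero.\<close>
lemma integral_directional_derivative_eq_0:
  fixes a b e :: "'a::euclidean_space" and h g :: "'a \<Rightarrow> real"
  assumes e: "e \<in> Basis"
    and int: "set_integrable lborel (box a b) g"
    and cont: "continuous_on (cbox a b) h"
    and deriv: "\<And>x. x \<in> box a b \<Longrightarrow> ((\<lambda>t. h (x + t *\<^sub>R e)) has_real_derivative g x) (at 0)"
    and faces: "\<And>x. x \<in> cbox a b \<Longrightarrow> x \<bullet> e = a \<bullet> e \<Longrightarrow> h (x + (b \<bullet> e - a \<bullet> e) *\<^sub>R e) = h x"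
  shows "(LINT x:box a b|lborel. g x) = 0"
proof -
  interpret product_sigma_finite "\<lambda>_::'a. lborel :: real measure" ..
  define I where "I = Basis - {e}"
  define G where "G x = indicator (box a b) x *\<^sub>R g x" for x
  define s where "s \<phi> = (\<Sum>i\<in>Basis. \<phi> i *\<^sub>R i)" for \<phi> :: "'a \<Rightarrow> real"
  have Basis_I: "Basis = insert e I" "finite I" "e \<notin> I"
    using e by (auto simp: I_def)
  have lborel_s: "lborel = distr (Pi\<^sub>M (insert e I) (\<lambda>_. lborel)) borel s"
    unfolding s_def Basis_I(1)[symmetric] by (rule lborel_eq)
  have s_meas: "s \<in> measurable (Pi\<^sub>M (insert e I) (\<lambda>_. lborel)) borel"
    unfolding s_def Basis_I(1)[symmetric] by measurable
  have G_int: "integrable lborel G"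
    using int unfolding G_def set_integrable_def .
  then have G_meas: "G \<in> borel_measurable borel"
    by auto
  have slice: "(\<integral>y. G (s (x(e := y))) \<partial>lborel) = 0" for x :: "'a \<Rightarrow> real"
  proof -
    \<comment> \<open>The line over \<open>x\<close>: it is parallel to \<open>e\<close> and meets the hyperplane orthogonal to \<open>e\<close> in \<open>c\<close>.\<close>
    define c where "c = (\<Sum>i\<in>I. x i *\<^sub>R i)"
    have s_upd: "s (x(e := y)) = c + y *\<^sub>R e" for y
      using Basis_I(2,3) unfolding s_def c_def Basis_I(1)
      by (auto simp: sum.insert add.commute intro!: sum.cong)
    have c_e: "c \<bullet> e = 0"
      using e Basis_I(2,3) I_def unfolding c_def inner_sum_left
      by (auto intro!: sum.neutral simp: inner_not_same_Basis)
    have c_i: "(c + y *\<^sub>R e) \<bullet> i = c \<bullet> i" if "i \<in> I" for i y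
      using that e by (auto simp: I_def inner_add_left inner_not_same_Basis)
    have e_coord: "(c + y *\<^sub>R e) \<bullet> e = y" for y
      using e c_e by (simp add: inner_add_left)
    have in_box: "c + y *\<^sub>R e \<in> box a b \<longleftrightarrow>
        (\<forall>i\<in>I. a \<bullet> i < c \<bullet> i \<and> c \<bullet> i < b \<bullet> i) \<and> a \<bullet> e < y \<and> y < b \<bullet> e" for y
      unfolding mem_box Basis_I(1) by (auto simp: c_i e_coord)
    have segment: "c + y *\<^sub>R e \<in> cbox a b"
      if "\<forall>i\<in>I. a \<bullet> i < c \<bullet> i \<and> c \<bullet> i < b \<bullet> i" "a \<bullet> e \<le> y" "y \<le> b \<bullet> e" for y
      using that unfolding mem_box Basis_I(1) by (auto simp: c_i e_coord intro: less_imp_le)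
    show ?thesis
    proof (cases "(\<forall>i\<in>I. a \<bullet> i < c \<bullet> i \<and> c \<bullet> i < b \<bullet> i) \<and> a \<bullet> e < b \<bullet> e")
      case False
      then have "G (c + y *\<^sub>R e) = 0" for y
        using in_box[of y] by (auto simp: G_def indicator_def)
      then show ?thesis by (simp add: s_upd)
    next
      case True
      have "((\<lambda>y. g (c + y *\<^sub>R e)) has_integral
              h (c + (b \<bullet> e) *\<^sub>R e) - h (c + (a \<bullet> e) *\<^sub>R e)) {a \<bullet> e..b \<bullet> e}"
      proof (rule fundamental_theorem_of_calculus_interior)
        show "continuous_on {a \<bullet> e..b \<bullet> e} (\<lambda>y. h (c + y *\<^sub>R e))"
          using True segment
          by (intro continuous_on_compose2[OF cont] continuous_intros) auto
        fix y assume y: "y \<in> {a \<bullet> e<..<b \<bullet> e}"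
        then have "c + y *\<^sub>R e \<in> box a b" using True in_box by auto
        from deriv[OF this]
        have "((\<lambda>t. h (c + y *\<^sub>R e + t *\<^sub>R e)) has_real_derivative g (c + y *\<^sub>R e)) (at 0)" .
        then have "((\<lambda>t. h (c + t *\<^sub>R e)) has_real_derivative g (c + y *\<^sub>R e)) (at (0 + y))"
          by (subst DERIV_shift) (simp add: algebra_simps)
        then show "((\<lambda>y. h (c + y *\<^sub>R e)) has_vector_derivative g (c + y *\<^sub>R e)) (at y)"
          by (simp add: has_real_derivative_iff_has_vector_derivative)
      qed (use True in auto)
      moreover have "h (c + (b \<bullet> e) *\<^sub>R e) = h (c + (a \<bullet> e) *\<^sub>R e)"
        using faces[of "c + (a \<bullet> e) *\<^sub>R e"] True segment[of "a \<bullet> e"] e_coord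
        by (auto simp: algebra_simps)
      ultimately have "((\<lambda>y. g (c + y *\<^sub>R e)) has_integral 0) {a \<bullet> e<..<b \<bullet> e}"
        using has_integral_open_interval[of "\<lambda>y. g (c + y *\<^sub>R e)" 0 "a \<bullet> e" "b \<bullet> e"]
        by simp
      then have "((\<lambda>y. if y \<in> {a \<bullet> e<..<b \<bullet> e} then g (c + y *\<^sub>R e) else 0) has_integral 0) UNIV"
        by (subst has_integral_restrict_UNIV)
      moreover have "(\<lambda>y. if y \<in> {a \<bullet> e<..<b \<bullet> e} then g (c + y *\<^sub>R e) else 0) =
          (\<lambda>y. G (s (x(e := y))))"
        using True by (auto simp: fun_eq_iff G_def s_upd in_box indicator_def)
      ultimately have hk: "((\<lambda>y. G (s (x(e := y)))) has_integral 0) UNIV"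
        by simp
      \<comment> \<open>Fubini gives integrability only on almost every line; on the others the Lebesgue
        integral is zero by convention, which is the value needed here.\<close>
      show ?thesis
      proof (cases "integrable lborel (\<lambda>y. G (s (x(e := y))))")
        case True
        then show ?thesis
          using has_integral_integral_lborel hk has_integral_unique by blast
      qed (rule not_integrable_integral_eq)
    qed
  qed
  have "integrable (Pi\<^sub>M (insert e I) (\<lambda>_. lborel)) (\<lambda>\<phi>. G (s \<phi>))"
    using G_int s_meas G_meas by (subst (asm) lborel_s) (simp add: integrable_distr_eq)
  then have "(\<integral>\<phi>. G (s \<phi>) \<partial>Pi\<^sub>M (insert e I) (\<lambda>_. lborel)) = 0"
    using product_integral_insert[OF Basis_I(2,3), of "\<lambda>\<phi>. G (s \<phi>)"] slice by simp
  then have "integral\<^sup>L lborel G = 0"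
    by (subst lborel_s) (simp add: integral_distr[OF s_meas G_meas])
  then show ?thesis
    by (simp add: set_lebesgue_integral_def G_def[abs_def])
qed

section \<open>Partial derivatives\<close>

lemma pd_eqI: "(f has_derivative D) (at x) \<Longrightarrow> pd j f x = D (axis j 1)"
  unfolding pd_def by (metis frechet_derivative_at)

lemma pd_bounded_linear:
  assumes "bounded_linear L" "f differentiable at x"
  shows "pd j (\<lambda>y. L (f y)) x = L (pd j f x)"
proof -
  have "(f has_derivative frechet_derivative f (at x)) (at x)"
    using assms(2) frechet_derivative_works by blast
  from pd_eqI[OF bounded_linear.has_derivative[OF assms(1) this]]
  show ?thesis by (simp add: pd_def)
qed

lemma pd_diff:
  assumes "f differentiable at x" "g differentiable at x"
  shows "pd j (\<lambda>y. f y - g y) x = pd j f x - pd j g x"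
  using assms pd_eqI[OF has_derivative_diff, of f _ x g]
  unfolding frechet_derivative_works pd_def by blast

text \<open>\<open>pd\<close> is defined by a choice among the derivatives at \<open>x\<close>, and \<open>f\<close> and \<open>g\<close> have the same ones.\<close>
lemma pd_cong_open:
  assumes "open S" "x \<in> S" "\<And>y. y \<in> S \<Longrightarrow> f y = g y"
  shows "pd j f x = pd j g x"
proof -
  have "(f has_derivative D) (at x) \<longleftrightarrow> (g has_derivative D) (at x)" for D
    using has_derivative_transform_within_open[of f D x UNIV S g]
      has_derivative_transform_within_open[of g D x UNIV S f] assms by auto
  then show ?thesis
    by (simp add: pd_def frechet_derivative_def)
qed

text \<open>As a function, \<open>f\<close> equals its translate by a period, so it has the same derivatives at \<open>x\<close> and at the
  translated point.\<close>
lemma pd_periodic: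
  assumes "periodic a b f"
  shows "periodic a b (pd j f)"
  unfolding periodic_def
proof (intro allI)
  fix x i
  let ?s = "axis i (b $ i - a $ i)"
  have shift: "f (y + ?s) = f y" for y
    using assms unfolding periodic_def by blast
  have "(f has_derivative D) (at (x + ?s)) \<longleftrightarrow> (f has_derivative D) (at x)" for D
  proof
    assume "(f has_derivative D) (at (x + ?s))"
    from has_derivative_compose[of "\<lambda>y. y + ?s" "\<lambda>k. k" x UNIV f D, OF _ this]
    moreover have "((\<lambda>y. y + ?s) has_derivative (\<lambda>k. k)) (at x)"
      by (auto intro!: derivative_eq_intros)
    ultimately show "(f has_derivative D) (at x)"
      by (simp add: shift)
  next
    have unshift: "f (y - ?s) = f y" for y
      using shift[of "y - ?s"] by simp
    assume "(f has_derivative D) (at x)"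
    then have "(f has_derivative D) (at (x + ?s - ?s))" by simp
    from has_derivative_compose[of "\<lambda>y. y - ?s" "\<lambda>k. k" "x + ?s" UNIV f D, OF _ this]
    moreover have "((\<lambda>y. y - ?s) has_derivative (\<lambda>k. k)) (at (x + ?s))"
      by (auto intro!: derivative_eq_intros)
    ultimately show "(f has_derivative D) (at (x + ?s))"
      by (simp add: unshift)
  qed
  then show "pd j f (x + ?s) = pd j f x"
    by (simp add: pd_def frechet_derivative_def)
qed

section \<open>Functions that are smooth up to the boundary\<close>

lemma Ck_closed_0_D: "Ck_closed k S f \<Longrightarrow> Ck_closed 0 S f"
  by (cases k) auto

lemma Ck_closed_differentiable:
  assumes "open S" "Ck_closed (Suc k) S f" "x \<in> S"
  shows "f differentiable at x"
  using assms by (simp add: differentiable_on_eq_differentiable_at)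

lemma Ck_closed_cong:
  assumes "open S"
  shows "Ck_closed k S f \<Longrightarrow> (\<And>x. x \<in> S \<Longrightarrow> f x = g x) \<Longrightarrow> Ck_closed k S g"
proof (induction k arbitrary: f g)
  case 0
  then show ?case by auto
next
  case (Suc k)
  have "g differentiable_on S"
    unfolding differentiable_on_eq_differentiable_at[OF assms]
  proof
    fix x assume x: "x \<in> S"
    then obtain D where "(f has_derivative D) (at x)"
      using Ck_closed_differentiable[OF assms Suc.prems(1)] unfolding differentiable_def by blast
    then have "(g has_derivative D) (at x)"
      by (rule has_derivative_transform_within_open[OF _ assms x]) (rule Suc.prems(2))
    then show "g differentiable at x"
      unfolding differentiable_def by blast
  qed
  moreover have "Ck_closed k S (pd j g)" for j
  proof (rule Suc.IH)
    show "Ck_closed k S (pd j f)"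
      using Suc.prems(1) by simp
    show "pd j f x = pd j g x" if "x \<in> S" for x
      by (rule pd_cong_open[OF assms that Suc.prems(2)])
  qed
  moreover have "Ck_closed 0 S g"
  proof -
    obtain h where "continuous_on (closure S) h" "\<forall>x\<in>S. h x = f x"
      using Suc.prems(1) by auto
    then show ?thesis
      using Suc.prems(2) by auto
  qed
  ultimately show ?case
    by auto
qed

lemma Ck_closed_lower: "Ck_closed (Suc k) S f \<Longrightarrow> Ck_closed k S f"
  by (induction k arbitrary: f) auto

lemma Ck_closed_subset:
  assumes "S \<subseteq> S'"
  shows "Ck_closed k S' f \<Longrightarrow> Ck_closed k S f"
proof (induction k arbitrary: f)
  case 0
  then show ?case
    using assms closure_mono[OF assms] by (auto intro: continuous_on_subset)
next
  case (Suc k)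
  obtain g where "continuous_on (closure S') g" "\<forall>x\<in>S'. g x = f x"
    using Suc.prems by auto
  then have "Ck_closed 0 S f"
    using assms continuous_on_subset[OF _ closure_mono[OF assms]] by auto
  moreover have "f differentiable_on S"
    using Suc.prems assms by (auto intro: differentiable_on_subset)
  ultimately show ?case
    using Suc by auto
qed

lemma Ck_closed_bounded_linear:
  assumes "open S" "bounded_linear L"
  shows "Ck_closed k S f \<Longrightarrow> Ck_closed k S (\<lambda>x. L (f x))"
proof (induction k arbitrary: f)
  case 0
  then obtain g where "continuous_on (closure S) g" "\<forall>x\<in>S. g x = f x" by auto
  then show ?case
    using bounded_linear.continuous_on[OF assms(2)]
    by (auto intro!: exI[of _ "\<lambda>x. L (g x)"])
next
  case (Suc k)
  have ext: "Ck_closed 0 S (\<lambda>x. L (f x))"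
  proof -
    obtain g where "continuous_on (closure S) g" "\<forall>x\<in>S. g x = f x" using Suc.prems by auto
    then show ?thesis
      using bounded_linear.continuous_on[OF assms(2)]
      by (auto intro!: exI[of _ "\<lambda>x. L (g x)"])
  qed
  have d: "f differentiable at x" if "x \<in> S" for x
    using Ck_closed_differentiable assms(1) Suc.prems that by blast
  have "(\<lambda>x. L (f x)) differentiable_on S"
    unfolding differentiable_on_eq_differentiable_at[OF assms(1)]
    using d bounded_linear.has_derivative[OF assms(2)] unfolding differentiable_def by blast
  moreover have "Ck_closed k S (pd j (\<lambda>x. L (f x)))" for j
  proof (rule Ck_closed_cong[OF assms(1)])
    show "Ck_closed k S (\<lambda>x. L (pd j f x))"
      using Suc by auto
  qed (simp add: pd_bounded_linear[OF assms(2) d])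
  ultimately show ?case
    using ext by auto
qed

text \<open>Sums, products and inner products of functions that extend continuously to the closure are instances,
  with \<open>c\<close> the respective operation.\<close>
lemma Ck_closed_0_combine:
  assumes "continuous_on UNIV (\<lambda>z. c (fst z) (snd z))" "Ck_closed 0 S f" "Ck_closed 0 S g"
  shows "Ck_closed 0 S (\<lambda>x. c (f x) (g x))"
proof -
  obtain f' g' where *: "continuous_on (closure S) f'" "continuous_on (closure S) g'"
    "\<forall>x\<in>S. f' x = f x" "\<forall>x\<in>S. g' x = g x"
    using assms(2,3) by auto
  have "continuous_on (closure S) (\<lambda>x. c (f' x) (g' x))"
    using continuous_on_compose2[OF assms(1) continuous_on_Pair[OF *(1,2)]] by simp
  then show ?thesis
    using * by (auto intro!: exI[of _ "\<lambda>x. c (f' x) (g' x)"])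
qed

lemma Ck_closed_diff:
  assumes "open S"
  shows "Ck_closed k S f \<Longrightarrow> Ck_closed k S g \<Longrightarrow> Ck_closed k S (\<lambda>x. f x - g x)"
proof (induction k arbitrary: f g)
  case 0
  show ?case
    by (rule Ck_closed_0_combine[where c = "(-)", OF _ 0]) (intro continuous_intros)
next
  case (Suc k)
  have d: "f differentiable at x" "g differentiable at x" if "x \<in> S" for x
    using Ck_closed_differentiable assms Suc.prems that by blast+
  have "(\<lambda>x. f x - g x) differentiable_on S"
    using Suc.prems by (auto intro: differentiable_on_diff)
  moreover have "Ck_closed k S (pd j (\<lambda>x. f x - g x))" for j
  proof (rule Ck_closed_cong[OF assms])
    show "Ck_closed k S (\<lambda>x. pd j f x - pd j g x)"
      using Suc by auto
  qed (simp add: pd_diff d)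
  moreover have "Ck_closed 0 S (\<lambda>x. f x - g x)"
    by (rule Ck_closed_0_combine[where c = "(-)", OF _ Suc.prems[THEN Ck_closed_0_D]])
      (intro continuous_intros)
  ultimately show ?case by auto
qed

lemma Ck_closed_0_inner:
  "Ck_closed 0 S f \<Longrightarrow> Ck_closed 0 S g \<Longrightarrow> Ck_closed 0 S (\<lambda>x. f x \<bullet> g x)"
  by (rule Ck_closed_0_combine[where c = "(\<bullet>)"]) (intro continuous_intros)

lemma Ck_closed_0_scaleR:
  "Ck_closed 0 S f \<Longrightarrow> Ck_closed 0 S g \<Longrightarrow> Ck_closed 0 S (\<lambda>x. f x *\<^sub>R g x)"
  by (rule Ck_closed_0_combine[where c = "(*\<^sub>R)"]) (intro continuous_intros)

lemma Ck_closed_0_const: "Ck_closed 0 S (\<lambda>x. c)"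
  by (auto intro!: exI[of _ "\<lambda>x. c"])

lemma Ck_closed_0_sum:
  "finite I \<Longrightarrow> (\<And>i. i \<in> I \<Longrightarrow> Ck_closed 0 S (f i)) \<Longrightarrow> Ck_closed 0 S (\<lambda>x. \<Sum>i\<in>I. f i x)"
proof (induction rule: finite_induct)
  case (insert i I)
  have "Ck_closed 0 S (\<lambda>x. f i x + (\<Sum>i\<in>I. f i x))"
    using insert by (intro Ck_closed_0_combine[where c = "(+)"] continuous_intros) blast+
  then show ?case
    using insert by simp
qed (simp only: sum.empty Ck_closed_0_const)

section \<open>Integrability on a box\<close>

text \<open>The continuous extension is bounded on the compact closure of the box.\<close>
lemma Ck_closed_0_set_integrable:
  fixes f :: "real^'d \<Rightarrow> 'b::euclidean_space"
  assumes "Ck_closed 0 (box a b) f"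
  shows "set_integrable lborel (box a b) f"
proof -
  obtain g where g: "continuous_on (closure (box a b)) g" "\<forall>x\<in>box a b. g x = f x"
    using assms by auto
  have "compact (closure (box a b))"
    by (simp add: bounded_box)
  then have "set_integrable lborel (closure (box a b)) g"
    using g(1) unfolding set_integrable_def by (intro borel_integrable_compact)
  then have "set_integrable lborel (box a b) g"
    by (rule set_integrable_subset) (auto intro: closure_subset[THEN subsetD])
  then show ?thesis
    using g(2) by (subst set_integrable_cong[OF refl refl, of _ _ g]) auto
qed

text \<open>Fubini's theorem and the integrability of continuous functions concern the Borel measure \<open>lborel\<close>,
  while the \<open>L2\<close> inner product is defined with its completion \<open>lebesgue\<close>; this lemma and the next one
  mediate between the two.\<close>
lemma set_integrable_lebesgue:
  fixes f :: "'a::euclidean_space \<Rightarrow> 'b::euclidean_space"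
  assumes "set_integrable lborel S f"
  shows "set_integrable lebesgue S f"
  using assms unfolding set_integrable_def
  by (subst integrable_completion) auto

lemma set_lebesgue_integral_lebesgue:
  fixes f :: "'a::euclidean_space \<Rightarrow> 'b::euclidean_space"
  assumes "set_integrable lborel S f"
  shows "(LINT x:S|lebesgue. f x) = (LINT x:S|lborel. f x)"
  using assms unfolding set_integrable_def set_lebesgue_integral_def
  by (subst integral_completion) auto

lemma Ck_closed_0_inner_integrable:
  fixes f g :: "real^'d \<Rightarrow> 'b::euclidean_space"
  assumes "Ck_closed 0 (box a b) f" "Ck_closed 0 (box a b) g"
  shows "set_integrable lebesgue (box a b) (\<lambda>x. f x \<bullet> g x)"
  by (intro set_integrable_lebesgue Ck_closed_0_set_integrable Ck_closed_0_inner assms)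

lemma set_integral_sum:
  fixes f :: "'i \<Rightarrow> 'a \<Rightarrow> 'b::{banach, second_countable_topology}"
  assumes "\<And>i. i \<in> I \<Longrightarrow> set_integrable M S (f i)"
  shows "(LINT x:S|M. (\<Sum>i\<in>I. f i x)) = (\<Sum>i\<in>I. LINT x:S|M. f i x)"
  using assms unfolding set_integrable_def set_lebesgue_integral_def
  by (simp add: scaleR_sum_right)

section \<open>Integration by parts\<close>

text \<open>The condition under which integrating \<open>v \<bullet> w\<close> by parts on the box leaves no boundary term in any
  coordinate direction. It speaks of continuous extensions \<open>V\<close> and \<open>W\<close> because \<open>v\<close> and \<open>w\<close> may have
  arbitrary values off the open box, as a partial derivative or a pressure does in the Dirichlet case.\<close>
definition face_products_match ::
  "real^'d::finite \<Rightarrow> real^'d \<Rightarrow> (real^'d \<Rightarrow> 'b::euclidean_space) \<Rightarrow> (real^'d \<Rightarrow> 'b) \<Rightarrow> bool" where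
  "face_products_match a b v w \<longleftrightarrow>
     (\<exists>V W. continuous_on (cbox a b) V \<and> continuous_on (cbox a b) W \<and>
        (\<forall>x\<in>box a b. V x = v x \<and> W x = w x) \<and>
        (\<forall>j. \<forall>x\<in>cbox a b. x $ j = a $ j \<longrightarrow>
           V (x + axis j (b $ j - a $ j)) \<bullet> W (x + axis j (b $ j - a $ j)) = V x \<bullet> W x))"

text \<open>The product rule makes \<open>pd j v \<bullet> w + v \<bullet> pd j w\<close> the derivative of \<open>v \<bullet> w\<close> in the direction of the
  \<open>j\<close>-th axis, and the product has matching values on the two faces orthogonal to that axis.\<close>
lemma integration_by_parts_pd:
  fixes v w :: "real^'d::finite \<Rightarrow> 'b::euclidean_space"
  assumes v: "Ck_closed 1 (box a b) v" and w: "Ck_closed 1 (box a b) w"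
    and faces: "face_products_match a b v w"
  shows "L2_inner (box a b) (pd j v) w = - L2_inner (box a b) v (pd j w)"
proof -
  obtain V W where VW: "continuous_on (cbox a b) V" "continuous_on (cbox a b) W"
    "\<And>x. x \<in> box a b \<Longrightarrow> V x = v x \<and> W x = w x"
    "\<And>x. x \<in> cbox a b \<Longrightarrow> x $ j = a $ j \<Longrightarrow>
       V (x + axis j (b $ j - a $ j)) \<bullet> W (x + axis j (b $ j - a $ j)) = V x \<bullet> W x"
    using faces unfolding face_products_match_def by blast
  have line_axis: "c *\<^sub>R axis j (1::real) = axis j c" for c
    by (simp add: axis_def vec_eq_iff)
  let ?g1 = "\<lambda>x. pd j v x \<bullet> w x" and ?g2 = "\<lambda>x. v x \<bullet> pd j w x"
  have C0: "Ck_closed 0 (box a b) v" "Ck_closed 0 (box a b) w"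
    "Ck_closed 0 (box a b) (pd j v)" "Ck_closed 0 (box a b) (pd j w)"
    using v w by auto
  have int: "set_integrable lborel (box a b) ?g1" "set_integrable lborel (box a b) ?g2"
    using C0 by (auto intro!: Ck_closed_0_set_integrable Ck_closed_0_inner simp del: Ck_closed.simps)
  have "(LINT x:box a b|lborel. ?g1 x + ?g2 x) = 0"
  proof (rule integral_directional_derivative_eq_0[where e = "axis j 1" and h = "\<lambda>x. V x \<bullet> W x"])
    show "continuous_on (cbox a b) (\<lambda>x. V x \<bullet> W x)"
      by (intro continuous_intros VW)
    fix x assume x: "x \<in> box a b"
    have "v differentiable at x" "w differentiable at x"
      using v w x Ck_closed_differentiable[OF open_box] by (metis One_nat_def)+
    then have "((\<lambda>y. v y \<bullet> w y) has_derivative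
        (\<lambda>k. v x \<bullet> frechet_derivative w (at x) k + frechet_derivative v (at x) k \<bullet> w x)) (at x)"
      by (intro has_derivative_inner) (auto simp: frechet_derivative_works)
    then have D: "((\<lambda>y. V y \<bullet> W y) has_derivative
        (\<lambda>k. v x \<bullet> frechet_derivative w (at x) k + frechet_derivative v (at x) k \<bullet> w x)) (at x)"
      by (rule has_derivative_transform_within_open[OF _ open_box x]) (simp add: VW(3))
    have line: "((\<lambda>t. x + t *\<^sub>R axis j 1) has_derivative (\<lambda>t. t *\<^sub>R axis j (1::real))) (at (0::real))"
      by (auto intro!: derivative_eq_intros)
    have "((\<lambda>t. V (x + t *\<^sub>R axis j 1) \<bullet> W (x + t *\<^sub>R axis j 1)) has_derivative
        (\<lambda>t. v x \<bullet> frechet_derivative w (at x) (t *\<^sub>R axis j 1)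
             + frechet_derivative v (at x) (t *\<^sub>R axis j 1) \<bullet> w x)) (at 0)"
      using has_derivative_compose[OF line, of "\<lambda>y. V y \<bullet> W y"] D by simp
    moreover have "linear (frechet_derivative w (at x))" "linear (frechet_derivative v (at x))"
      using \<open>v differentiable at x\<close> \<open>w differentiable at x\<close> linear_frechet_derivative by blast+
    from this[THEN linear_scale] have "(\<lambda>t. v x \<bullet> frechet_derivative w (at x) (t *\<^sub>R axis j 1)
             + frechet_derivative v (at x) (t *\<^sub>R axis j 1) \<bullet> w x) = (*) (?g1 x + ?g2 x)"
      by (simp add: fun_eq_iff pd_def distrib_left mult.commute)
    ultimately show "((\<lambda>t. V (x + t *\<^sub>R axis j 1) \<bullet> W (x + t *\<^sub>R axis j 1)) has_real_derivative
        ?g1 x + ?g2 x) (at 0)"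
      unfolding has_field_derivative_def by simp
  next
    fix x assume "x \<in> cbox a b" "x \<bullet> axis j 1 = a \<bullet> axis j 1"
    then show "V (x + (b \<bullet> axis j 1 - a \<bullet> axis j 1) *\<^sub>R axis j 1) \<bullet>
        W (x + (b \<bullet> axis j 1 - a \<bullet> axis j 1) *\<^sub>R axis j 1) = V x \<bullet> W x"
      using VW(4)[of x] by (simp add: inner_axis line_axis)
  qed (auto simp: axis_in_Basis_iff set_integral_add int)
  then show ?thesis
    using int unfolding L2_inner_def by (simp add: set_lebesgue_integral_lebesgue)
qed

lemma face_products_match_dirichlet:
  assumes v: "Ck_closed 0 (box a b) v"
    and w: "continuous_on (cbox a b) w" "\<And>x. x \<in> cbox a b - box a b \<Longrightarrow> w x = 0"
    and sides: "\<forall>j. a $ j < b $ j"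
  shows "face_products_match a b v w"
proof -
  have "box a b \<noteq> {}"
    using sides by (simp add: interval_ne_empty_cart)
  then have cl: "closure (box a b) = cbox a b"
    by simp
  obtain V where V: "continuous_on (cbox a b) V" "\<forall>x\<in>box a b. V x = v x"
    using v cl by auto
  have "w x = 0" "w (x + axis j (b $ j - a $ j)) = 0"
    if x: "x \<in> cbox a b" "x $ j = a $ j" for x j
  proof -
    show "w x = 0"
    proof (rule w(2))
      have "a $ j < x $ j" if "x \<in> box a b"
        using that by (simp add: mem_box_cart)
      then show "x \<in> cbox a b - box a b"
        using x by auto
    qed
    have "x + axis j (b $ j - a $ j) \<in> cbox a b"
      using x sides by (auto simp: mem_box_cart axis_def less_imp_le)
    moreover have "x + axis j (b $ j - a $ j) \<notin> box a b"
    proof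
      assume "x + axis j (b $ j - a $ j) \<in> box a b"
      then have "(x + axis j (b $ j - a $ j)) $ j < b $ j"
        unfolding mem_box_cart by blast
      then show False
        using x by (simp add: axis_def)
    qed
    ultimately show "w (x + axis j (b $ j - a $ j)) = 0"
      by (intro w(2)) blast
  qed
  then show ?thesis
    using V w(1) unfolding face_products_match_def
    by (intro exI[of _ V] exI[of _ w]) auto
qed

text \<open>Periodic fields are defined and continuous everywhere, so they are their own extensions.\<close>
lemma face_products_match_periodic:
  assumes "Ck_closed 0 UNIV v" "Ck_closed 0 UNIV w" "periodic a b v" "periodic a b w"
  shows "face_products_match a b v w"
proof -
  have "continuous_on UNIV v" "continuous_on UNIV w"
    using assms(1,2) by (auto cong: continuous_on_cong)
  then show ?thesis
    using assms(3,4) unfolding face_products_match_def periodic_def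
    by (intro exI[of _ v] exI[of _ w]) (auto intro: continuous_on_subset)
qed

section \<open>The terms of the momentum equation tested with the velocity\<close>

lemma L2_norm_power2: "(L2_norm S v)\<^sup>2 = L2_inner S v v"
  unfolding L2_norm_def L2_inner_def set_lebesgue_integral_def
  by (subst real_sqrt_pow2) (auto intro!: integral_nonneg_AE AE_I2)

text \<open>Each second derivative \<open>pd j (pd j u)\<close> is integrated by parts against \<open>u\<close>; the squares
  \<open>\<parallel>pd j u\<parallel>\<^sup>2\<close> that result are the squared norms of the columns of the gradient matrix.\<close>
lemma L2_inner_laplacian_self:
  fixes u :: "real^'d::finite \<Rightarrow> real^'d"
  assumes u: "Ck_closed 2 (box a b) u"
    and faces: "\<And>j. face_products_match a b (pd j u) u"
  shows "L2_inner (box a b) (laplacian u) u = - (L2_norm (box a b) (vgrad u))\<^sup>2"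
proof -
  have u2: "Ck_closed (Suc 1) (box a b) u"
    using u by (simp only: Suc_1)
  then have C1: "Ck_closed 1 (box a b) u" "Ck_closed 1 (box a b) (pd j u)" for j
    using Ck_closed_lower by (blast, simp only: Ck_closed.simps)
  have C0: "Ck_closed 0 (box a b) u" "Ck_closed 0 (box a b) (pd j u)" 
     "Ck_closed 0 (box a b) (pd j (pd j u))" for j
    using C1(1) C1(2)[of j] by auto
  have int: "set_integrable lebesgue (box a b) (\<lambda>x. pd j (pd j u) x \<bullet> u x)"
    "set_integrable lebesgue (box a b) (\<lambda>x. pd j u x \<bullet> pd j u x)" for j
    by (intro Ck_closed_0_inner_integrable C0)+
  have frob: "vgrad u x \<bullet> vgrad u x = (\<Sum>j\<in>UNIV. pd j u x \<bullet> pd j u x)" for x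
    unfolding vgrad_def inner_vec_def by simp (rule sum.swap)
  have "L2_inner (box a b) (laplacian u) u = (\<Sum>j\<in>UNIV. L2_inner (box a b) (pd j (pd j u)) u)"
    unfolding L2_inner_def laplacian_def inner_sum_left using int by (simp add: set_integral_sum)
  also have "\<dots> = - (\<Sum>j\<in>UNIV. L2_inner (box a b) (pd j u) (pd j u))"
    by (simp add: integration_by_parts_pd[OF C1(2) C1(1) faces] sum_negf)
  also have "(\<Sum>j\<in>UNIV. L2_inner (box a b) (pd j u) (pd j u)) = L2_inner (box a b) (vgrad u) (vgrad u)"
    unfolding L2_inner_def frob using int by (simp add: set_integral_sum)
  finally show ?thesis
    by (simp add: L2_norm_power2)
qed

text \<open>Integration by parts in every coordinate moves the derivatives from \<open>q\<close> to \<open>u\<close>, where they add up to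
  the divergence.\<close>
lemma L2_inner_grad_divergence_free:
  fixes u :: "real^'d::finite \<Rightarrow> real^'d" and q :: "real^'d \<Rightarrow> real"
  assumes q: "Ck_closed 1 (box a b) q" and u: "Ck_closed 1 (box a b) u"
    and faces: "\<And>j. face_products_match a b q (\<lambda>x. u x $ j)"
    and div: "\<And>x. x \<in> box a b \<Longrightarrow> divergence u x = 0"
  shows "L2_inner (box a b) (grad q) u = 0"
proof -
  have C1: "Ck_closed 1 (box a b) (\<lambda>x. u x $ j)" for j
    using Ck_closed_bounded_linear[OF open_box bounded_linear_vec_nth u] .
  have C0: "Ck_closed 0 (box a b) q" "Ck_closed 0 (box a b) (pd j q)"
    "Ck_closed 0 (box a b) (\<lambda>x. u x $ j)" "Ck_closed 0 (box a b) (pd j (\<lambda>x. u x $ j))" for j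
    using q C1[of j] by auto
  have int: "set_integrable lebesgue (box a b) (\<lambda>x. pd j q x \<bullet> u x $ j)"
    "set_integrable lebesgue (box a b) (\<lambda>x. q x \<bullet> pd j (\<lambda>x. u x $ j) x)" for j
    by (intro Ck_closed_0_inner_integrable C0)+
  have pd_nth: "pd j (\<lambda>x. u x $ j) x = pd j u x $ j" if "x \<in> box a b" for x j
    using Ck_closed_differentiable[OF open_box, of 0 a b u x] u that
    by (intro pd_bounded_linear[OF bounded_linear_vec_nth]) auto
  have "L2_inner (box a b) (grad q) u = (\<Sum>j\<in>UNIV. L2_inner (box a b) (pd j q) (\<lambda>x. u x $ j))"
    unfolding L2_inner_def grad_def inner_vec_def using int
    by (simp add: set_integral_sum del: inner_real_def)
  also have "\<dots> = - (\<Sum>j\<in>UNIV. L2_inner (box a b) q (pd j (\<lambda>x. u x $ j)))"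
    by (simp add: integration_by_parts_pd[OF q C1 faces] sum_negf)
  also have "(\<Sum>j\<in>UNIV. L2_inner (box a b) q (pd j (\<lambda>x. u x $ j))) =
      (LINT x:box a b|lebesgue. (\<Sum>j\<in>UNIV. q x \<bullet> pd j (\<lambda>x. u x $ j) x))"
    unfolding L2_inner_def using int by (simp add: set_integral_sum del: inner_real_def)
  also have "\<dots> = (LINT x:box a b|lebesgue. 0)"
  proof (rule set_lebesgue_integral_cong)
    show "\<forall>x. x \<in> box a b \<longrightarrow> (\<Sum>j\<in>UNIV. q x \<bullet> pd j (\<lambda>x. u x $ j) x) = 0"
      using div by (auto simp: pd_nth divergence_def simp flip: sum_distrib_left)
  qed auto
  finally show ?thesis
    by (simp add: set_lebesgue_integral_def)
qed

text \<open>\<open>F v\<close> is only known to be square integrable. Against a bounded field this is enough, by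
  \<open>\<bar>f \<bullet> g\<bar> \<le> f \<bullet> f + g \<bullet> g\<close>.\<close>
lemma in_L2_inner_integrable:
  assumes f: "in_L2 (box a b) f" and g: "Ck_closed 0 (box a b) g"
  shows "set_integrable lebesgue (box a b) (\<lambda>x. f x \<bullet> g x)"
proof -
  have "set_integrable lebesgue (box a b) g"
    using g by (intro set_integrable_lebesgue Ck_closed_0_set_integrable)
  then have gm: "(\<lambda>x. indicator (box a b) x *\<^sub>R g x) \<in> borel_measurable lebesgue"
    unfolding set_integrable_def by auto
  have fm: "(\<lambda>x. indicator (box a b) x *\<^sub>R f x) \<in> borel_measurable lebesgue"
    using f unfolding in_L2_def set_borel_measurable_def by auto
  have eq: "(indicator (box a b) x *\<^sub>R f x) \<bullet> (indicator (box a b) x *\<^sub>R g x) =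
      indicator (box a b) x *\<^sub>R (f x \<bullet> g x)" for x
    by (auto simp: indicator_def)
  have meas: "set_borel_measurable lebesgue (box a b) (\<lambda>x. f x \<bullet> g x)"
    using borel_measurable_inner[OF fm gm] unfolding set_borel_measurable_def eq .
  have "set_integrable lebesgue (box a b) (\<lambda>x. f x \<bullet> f x + g x \<bullet> g x)"
    using f Ck_closed_0_inner_integrable[OF g g] unfolding in_L2_def
    by (intro set_integral_add(1)) blast+
  then show ?thesis
  proof (rule set_integrable_bound[OF _ meas])
    have "\<bar>f x \<bullet> g x\<bar> \<le> f x \<bullet> f x + g x \<bullet> g x" for x
    proof -
      have "0 \<le> (f x + g x) \<bullet> (f x + g x)" "0 \<le> (f x - g x) \<bullet> (f x - g x)"
        "0 \<le> f x \<bullet> f x" "0 \<le> g x \<bullet> g x"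
        by auto
      then show ?thesis
        by (simp add: inner_add_left inner_add_right inner_diff_left inner_diff_right inner_commute)
    qed
    then show "AE x in lebesgue. x \<in> box a b \<longrightarrow>
       norm (f x \<bullet> g x) \<le> norm (f x \<bullet> f x + g x \<bullet> g x)"
      by (intro AE_I2) (force simp: add_nonneg_nonneg)
  qed
qed

text \<open>The inner product is \<open>(F v, w) (G v, w) - (G v, w) (F v, w) = 0\<close>. The integrability hypotheses let the
  integral split into these two terms.\<close>
lemma L2_inner_B_map_self:
  fixes v w :: "real^'d::finite \<Rightarrow> real^'d"
  assumes "set_integrable lebesgue S (\<lambda>x. F v x \<bullet> w x)"
    and "set_integrable lebesgue S (\<lambda>x. G_map S F v x \<bullet> w x)"
  shows "set_integrable lebesgue S (\<lambda>x. B_map S F v w x \<bullet> w x)"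
    and "L2_inner S (B_map S F v w) w = 0"
proof -
  have eq: "B_map S F v w x \<bullet> w x =
      L2_inner S (F v) w * (G_map S F v x \<bullet> w x) - L2_inner S (G_map S F v) w * (F v x \<bullet> w x)" for x
    by (simp add: B_map_def inner_diff_left)
  show "set_integrable lebesgue S (\<lambda>x. B_map S F v w x \<bullet> w x)"
    unfolding eq using assms by auto
  show "L2_inner S (B_map S F v w) w = 0"
    unfolding L2_inner_def[of S "B_map S F v w"] eq using assms
    by (simp add: set_integral_diff) (simp add: L2_inner_def)
qed

lemma Ck_closed_0_G_map:
  assumes S: "open S" and v: "Ck_closed 1 S v"
  shows "Ck_closed 0 S (G_map S F v)"
proof -
  have "Ck_closed 0 S (convection v)"
    unfolding convection_def
  proof (rule Ck_closed_0_sum)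
    fix j
    have "Ck_closed 0 S v" "Ck_closed 0 S (pd j v)"
      using v by auto
    then show "Ck_closed 0 S (\<lambda>x. (v x $ j) *\<^sub>R pd j v x)"
      by (intro Ck_closed_0_scaleR Ck_closed_bounded_linear[OF S bounded_linear_vec_nth])
  qed simp
  then show ?thesis
    unfolding G_map_def by (auto intro!: Ck_closed_0_scaleR Ck_closed_0_const simp del: Ck_closed.simps)
qed

lemma Ck_closed_0_laplacian:
  assumes "Ck_closed 2 S v"
  shows "Ck_closed 0 S (laplacian v)"
  unfolding laplacian_def
proof (rule Ck_closed_0_sum)
  fix j
  have "Ck_closed (Suc (Suc 0)) S v"
    using assms by (simp only: numeral_2_eq_2)
  then show "Ck_closed 0 S (pd j (pd j v))"
    by auto
qed simp

text \<open>The gradient is expanded in the standard basis to reduce the vector field to its scalar components.\<close>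
lemma Ck_closed_0_grad:
  assumes "Ck_closed 1 S q"
  shows "Ck_closed 0 S (grad q)"
proof -
  have "grad q = (\<lambda>x. \<Sum>j\<in>UNIV. pd j q x *\<^sub>R axis j 1)"
  proof
    fix x
    show "grad q x = (\<Sum>j\<in>UNIV. pd j q x *\<^sub>R axis j 1)"
      using basis_expansion[of "grad q x"] by (simp add: grad_def scalar_mult_eq_scaleR)
  qed
  moreover have "Ck_closed 0 S (\<lambda>x. \<Sum>j\<in>UNIV. pd j q x *\<^sub>R axis j 1)"
  proof (rule Ck_closed_0_sum)
    fix j
    have "Ck_closed 0 S (pd j q)"
      using assms by simp
    then show "Ck_closed 0 S (\<lambda>x. pd j q x *\<^sub>R axis j 1)"
      by (rule Ck_closed_0_scaleR) (rule Ck_closed_0_const)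
  qed simp
  ultimately show ?thesis
    by simp
qed

section \<open>The energy balance of one step\<close>

text \<open>This is why the energy has the form it has: \<open>z\<close> and the extrapolation \<open>2 z - y\<close> carry the energy at the
  new level, \<open>y\<close> and \<open>2 y - x\<close> the energy at the old one, and the second difference is left over as
  numerical dissipation.\<close>
lemma bdf2_polarization:
  fixes x y z :: "'a::real_inner"
  shows "(3 *\<^sub>R z - 4 *\<^sub>R y + x) \<bullet> z =
    1/2 * (z \<bullet> z + (2 *\<^sub>R z - y) \<bullet> (2 *\<^sub>R z - y) - y \<bullet> y - (2 *\<^sub>R y - x) \<bullet> (2 *\<^sub>R y - x)
      + (z - 2 *\<^sub>R y + x) \<bullet> (z - 2 *\<^sub>R y + x))"
  by (simp add: inner_simps inner_commute)

text \<open>The momentum equation tested with \<open>z\<close> and integrated. The left side is the increment of the energy over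
  \<open>\<tau>\<close> plus the numerical dissipation; on the right only the viscous term survives.\<close>
lemma bdf2_step_energy_identity:
  fixes x y z :: "real^'d::finite \<Rightarrow> real^'d"
  assumes \<tau>: "\<tau> > 0" and F: "admissible_map (box a b) F"
    and C2: "Ck_closed 2 (box a b) x" "Ck_closed 2 (box a b) y" "Ck_closed 2 (box a b) z"
    and q: "Ck_closed 1 (box a b) q"
    and viscous_faces: "\<And>j. face_products_match a b (pd j z) z"
    and pressure_faces: "\<And>j. face_products_match a b q (\<lambda>\<xi>. z \<xi> $ j)"
    and force: "\<And>\<xi>. \<xi> \<in> box a b \<Longrightarrow> force \<xi> = 0"
    and step: "bdf2_step (box a b) \<nu> \<tau> F force x y z q"
  shows "1 / (4 * \<tau>) * ((L2_norm (box a b) z)\<^sup>2 + (L2_norm (box a b) (\<lambda>\<xi>. 2 *\<^sub>R z \<xi> - y \<xi>))\<^sup>2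
      - (L2_norm (box a b) y)\<^sup>2 - (L2_norm (box a b) (\<lambda>\<xi>. 2 *\<^sub>R y \<xi> - x \<xi>))\<^sup>2
      + (L2_norm (box a b) (\<lambda>\<xi>. z \<xi> - 2 *\<^sub>R y \<xi> + x \<xi>))\<^sup>2) =
    - \<nu> * (L2_norm (box a b) (vgrad z))\<^sup>2"
proof -
  let ?\<Omega> = "box a b"
  let ?v = "\<lambda>\<xi>. 2 *\<^sub>R y \<xi> - x \<xi>" and ?w = "\<lambda>\<xi>. 2 *\<^sub>R z \<xi> - y \<xi>"
    and ?d = "\<lambda>\<xi>. z \<xi> - 2 *\<^sub>R y \<xi> + x \<xi>"
  have double: "Ck_closed 2 ?\<Omega> (\<lambda>\<xi>. 2 *\<^sub>R g \<xi>)" if "Ck_closed 2 ?\<Omega> g" for g :: "real^'d \<Rightarrow> real^'d"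
    by (rule Ck_closed_bounded_linear[OF open_box bounded_linear_scaleR_right that])
  have v: "Ck_closed 2 ?\<Omega> ?v" and w: "Ck_closed 2 ?\<Omega> ?w"
    by (intro Ck_closed_diff[OF open_box] double C2)+
  have "Ck_closed 2 ?\<Omega> (\<lambda>\<xi>. z \<xi> - ?v \<xi>)"
    by (rule Ck_closed_diff[OF open_box C2(3) v])
  then have d: "Ck_closed 2 ?\<Omega> ?d"
    by (simp only: diff_diff_eq2 add_diff_eq diff_add_eq)
  note C0 = C2[THEN Ck_closed_0_D] v[THEN Ck_closed_0_D] w[THEN Ck_closed_0_D] d[THEN Ck_closed_0_D]
    Ck_closed_0_laplacian[OF C2(3)] Ck_closed_0_grad[OF q]
  have int: "set_integrable lebesgue ?\<Omega> (\<lambda>\<xi>. g \<xi> \<bullet> h \<xi>)"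
    if "Ck_closed 0 ?\<Omega> g" "Ck_closed 0 ?\<Omega> h" for g h :: "real^'d \<Rightarrow> real^'d"
    using Ck_closed_0_inner_integrable that .
  have C1: "Ck_closed 1 ?\<Omega> ?v" "Ck_closed 1 ?\<Omega> z"
    by (rule Ck_closed_lower, use v C2(3) in \<open>simp only: Suc_1\<close>)+
  have "in_L2 ?\<Omega> (F ?v)"
    using F v unfolding admissible_map_def by blast
  then have F_int: "set_integrable lebesgue ?\<Omega> (\<lambda>\<xi>. F ?v \<xi> \<bullet> z \<xi>)"
    by (rule in_L2_inner_integrable) (rule C0)
  have G_int: "set_integrable lebesgue ?\<Omega> (\<lambda>\<xi>. G_map ?\<Omega> F ?v \<xi> \<bullet> z \<xi>)"
    by (intro int C0 Ck_closed_0_G_map[OF open_box C1(1)])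
  note B = L2_inner_B_map_self[OF F_int G_int]
  have pressure: "L2_inner ?\<Omega> (grad q) z = 0"
    using step unfolding bdf2_step_def
    by (intro L2_inner_grad_divergence_free q C1 pressure_faces) blast
  have pointwise: "1 / (4 * \<tau>) * (z \<xi> \<bullet> z \<xi> + ?w \<xi> \<bullet> ?w \<xi> - y \<xi> \<bullet> y \<xi> - ?v \<xi> \<bullet> ?v \<xi> + ?d \<xi> \<bullet> ?d \<xi>) =
      \<nu> * (laplacian z \<xi> \<bullet> z \<xi>) - B_map ?\<Omega> F ?v z \<xi> \<bullet> z \<xi> - grad q \<xi> \<bullet> z \<xi>"
    if \<xi>: "\<xi> \<in> ?\<Omega>" for \<xi>
  proof -
    have "(1 / (2 * \<tau>)) *\<^sub>R (3 *\<^sub>R z \<xi> - 4 *\<^sub>R y \<xi> + x \<xi>) =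
        \<nu> *\<^sub>R laplacian z \<xi> - B_map ?\<Omega> F ?v z \<xi> - grad q \<xi>"
    proof -
      have eq: "s = l - n - g" if "s - l + n + g = 0" for s l n g :: "real^'d"
      proof -
        have "s - (l - n - g) = s - l + n + g" by simp
        then show ?thesis using that by simp
      qed
      have "(1 / (2 * \<tau>)) *\<^sub>R (3 *\<^sub>R z \<xi> - 4 *\<^sub>R y \<xi> + x \<xi>) - \<nu> *\<^sub>R laplacian z \<xi>
          + B_map ?\<Omega> F ?v z \<xi> + grad q \<xi> = force \<xi>"
        using step \<xi> unfolding bdf2_step_def by blast
      then show ?thesis
        unfolding force[OF \<xi>] by (rule eq)
    qed
    from arg_cong[OF this, of "\<lambda>s. s \<bullet> z \<xi>"]
    have "1 / (2 * \<tau>) * ((3 *\<^sub>R z \<xi> - 4 *\<^sub>R y \<xi> + x \<xi>) \<bullet> z \<xi>) =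
        \<nu> * (laplacian z \<xi> \<bullet> z \<xi>) - B_map ?\<Omega> F ?v z \<xi> \<bullet> z \<xi> - grad q \<xi> \<bullet> z \<xi>"
      by (simp only: inner_diff_left[of _ "grad q \<xi>"] inner_diff_left[of _ "B_map ?\<Omega> F ?v z \<xi>"]
          inner_scaleR_left)
    moreover have "1 / (2 * \<tau>) * (1/2 * r) = 1 / (4 * \<tau>) * r" for r
      by simp
    ultimately show ?thesis
      unfolding bdf2_polarization by (simp only:)
  qed
  have "(LINT \<xi>:?\<Omega>|lebesgue. 1 / (4 * \<tau>) * (z \<xi> \<bullet> z \<xi> + ?w \<xi> \<bullet> ?w \<xi> - y \<xi> \<bullet> y \<xi>
        - ?v \<xi> \<bullet> ?v \<xi> + ?d \<xi> \<bullet> ?d \<xi>)) =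
      (LINT \<xi>:?\<Omega>|lebesgue. \<nu> * (laplacian z \<xi> \<bullet> z \<xi>) - B_map ?\<Omega> F ?v z \<xi> \<bullet> z \<xi> - grad q \<xi> \<bullet> z \<xi>)"
    by (rule set_lebesgue_integral_cong) (simp, intro allI impI, rule pointwise)
  also have "\<dots> = \<nu> * L2_inner ?\<Omega> (laplacian z) z"
  proof -
    have "set_integrable lebesgue ?\<Omega> (\<lambda>\<xi>. \<nu> * (laplacian z \<xi> \<bullet> z \<xi>))"
      by (intro set_integrable_mult_right int C0)
    moreover have "set_integrable lebesgue ?\<Omega> (\<lambda>\<xi>. grad q \<xi> \<bullet> z \<xi>)"
      by (intro int C0)
    ultimately show ?thesis
      using B pressure unfolding L2_inner_def
      by (simp only: set_integral_diff set_integral_mult_right diff_zero)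
  qed
  also have "\<dots> = - \<nu> * (L2_norm ?\<Omega> (vgrad z))\<^sup>2"
    by (simp add: L2_inner_laplacian_self[OF C2(3) viscous_faces])
  also have "(LINT \<xi>:?\<Omega>|lebesgue. 1 / (4 * \<tau>) * (z \<xi> \<bullet> z \<xi> + ?w \<xi> \<bullet> ?w \<xi> - y \<xi> \<bullet> y \<xi>
        - ?v \<xi> \<bullet> ?v \<xi> + ?d \<xi> \<bullet> ?d \<xi>)) =
      1 / (4 * \<tau>) * ((L2_norm ?\<Omega> z)\<^sup>2 + (L2_norm ?\<Omega> ?w)\<^sup>2 - (L2_norm ?\<Omega> y)\<^sup>2 - (L2_norm ?\<Omega> ?v)\<^sup>2
        + (L2_norm ?\<Omega> ?d)\<^sup>2)"
    unfolding L2_norm_power2 L2_inner_def set_integral_mult_right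
    using int[OF C0(1) C0(1)] int[OF C0(2) C0(2)] int[OF C0(3) C0(3)] int[OF C0(4) C0(4)]
      int[OF C0(5) C0(5)] int[OF C0(6) C0(6)]
    by (simp only: set_integral_add set_integral_diff)
  finally show ?thesis .
qed

section \<open>Boundary conditions and the energy law\<close>

text \<open>These are the two products that the viscous term and the pressure term leave on the boundary.\<close>
lemma face_products_match_solution:
  assumes sides: "\<forall>j. a $ j < b $ j"
    and sol: "dirichlet_solution_space a b v q \<or> periodic_solution_space a b v q"
  shows "face_products_match a b (pd j v) v" "face_products_match a b q (\<lambda>x. v x $ j)"
  using sol
proof (atomize (full), elim disjE)
  assume D: "dirichlet_solution_space a b v q"
  have "box a b \<noteq> {}"
    using sides by (simp add: interval_ne_empty_cart)
  then have v: "continuous_on (cbox a b) v" "\<And>x. x \<in> cbox a b - box a b \<Longrightarrow> v x = 0"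
    using D unfolding dirichlet_solution_space_def homogeneous_dirichlet_def
    by (auto simp: frontier_box)
  have "Ck_closed 0 (box a b) (pd j v)" "Ck_closed 0 (box a b) q"
    using D unfolding dirichlet_solution_space_def by (auto simp: numeral_2_eq_2)
  then show "face_products_match a b (pd j v) v \<and> face_products_match a b q (\<lambda>x. v x $ j)"
    using v sides by (intro conjI face_products_match_dirichlet continuous_intros) auto
next
  assume P: "periodic_solution_space a b v q"
  then have per: "periodic a b v" "periodic a b q"
    by (auto simp: periodic_solution_space_def)
  have C0: "Ck_closed 0 UNIV v" "Ck_closed 0 UNIV (pd j v)" "Ck_closed 0 UNIV q"
    using P unfolding periodic_solution_space_def by (auto simp: numeral_2_eq_2)
  have "Ck_closed 0 UNIV (\<lambda>x. v x $ j)"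
    by (rule Ck_closed_bounded_linear[OF open_UNIV bounded_linear_vec_nth C0(1)])
  moreover have "periodic a b (\<lambda>x. v x $ j)"
    using per by (simp add: periodic_def)
  ultimately show "face_products_match a b (pd j v) v \<and> face_products_match a b q (\<lambda>x. v x $ j)"
    using C0 per pd_periodic[OF per(1)] by (intro conjI face_products_match_periodic)
qed

theorem theorem3p3:
  fixes a b :: "real^'d::finite"
    and \<Omega> :: "(real^'d) set"
    and \<nu> T \<tau> :: real
    and Nt :: nat
    and F :: "(real^'d \<Rightarrow> real^'d) \<Rightarrow> (real^'d \<Rightarrow> real^'d)"
    and f :: "real \<Rightarrow> real^'d \<Rightarrow> real^'d"
    and u :: "nat \<Rightarrow> real^'d \<Rightarrow> real^'d"
    and p :: "nat \<Rightarrow> real^'d \<Rightarrow> real"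
  assumes dim: "CARD('d) = 2 \<or> CARD('d) = 3"
    and sides: "\<forall>j. a $ j < b $ j"
    and domain: "\<Omega> = box a b"
    and nu: "\<nu> > 0"
    and T: "T > 0"
    and Nt: "Nt > 0"
    and tau: "\<tau> = T / real Nt"
    and F: "admissible_map \<Omega> F"
    and initial: "Ck_closed 2 \<Omega> (u 0)"
    and boundary: "(\<forall>n\<in>{1..Nt}. dirichlet_solution_space a b (u n) (p n)) \<or>
                   (\<forall>n\<in>{1..Nt}. periodic_solution_space a b (u n) (p n))"
    and no_force: "\<forall>t\<in>{0..T}. \<forall>x\<in>\<Omega>. f t x = 0"
    and bdf1: "bdf1_step \<Omega> \<nu> \<tau> F (f \<tau>) (u 0) (u 1) (p 1)"
    and bdf2: "\<forall>n\<in>{1..Nt - 1}.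
                 bdf2_step \<Omega> \<nu> \<tau> F (f (real (n + 1) * \<tau>)) (u (n - 1)) (u n) (u (n + 1)) (p (n + 1))"
  shows "\<forall>n\<in>{1..Nt - 1}.
           (bdf2_energy \<Omega> u (n + 1) - bdf2_energy \<Omega> u n) / \<tau> =
             - \<nu> * (L2_norm \<Omega> (vgrad (u (n + 1))))\<^sup>2
             - 1 / (4 * \<tau>) * (L2_norm \<Omega> (\<lambda>x. u (n + 1) x - 2 *\<^sub>R u n x + u (n - 1) x))\<^sup>2"
  proof
  fix n assume n: "n \<in> {1..Nt - 1}"
  have sol: "dirichlet_solution_space a b (u m) (p m) \<or> periodic_solution_space a b (u m) (p m)"
    if "m \<in> {1..Nt}" for m
    using boundary that by blast
  have regular: "Ck_closed 2 \<Omega> (u m) \<and> Ck_closed 1 \<Omega> (p m)" if "m \<in> {1..Nt}" for m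
    using sol[OF that] Ck_closed_subset[OF subset_UNIV]
    unfolding dirichlet_solution_space_def periodic_solution_space_def domain by metis
  have C2: "Ck_closed 2 \<Omega> (u m)" if "m \<le> Nt" for m
    using that initial regular[of m] by (cases m) auto
  have range: "n - 1 \<le> Nt" "n \<le> Nt" "n + 1 \<le> Nt" "n + 1 \<in> {1..Nt}"
    using n by auto
  have \<tau>: "\<tau> > 0"
    using T Nt tau by simp
  have "real (n + 1) * \<tau> \<le> real Nt * \<tau>"
    using range \<tau> by (intro mult_right_mono) auto
  moreover have "real Nt * \<tau> = T"
    using Nt tau by simp
  ultimately have time: "real (n + 1) * \<tau> \<in> {0..T}"
    using \<tau> by simp
  \<comment> \<open>Here \<open>A + B\<close> and \<open>C + D\<close> stand for four times the new and the old energy, \<open>N\<close> for the squared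
    norm of the second difference.\<close>
  have rearrange: "(1/4 * (A + B) - 1/4 * (C + D)) / \<tau> =
      1 / (4 * \<tau>) * (A + B - C - D + N) - 1 / (4 * \<tau>) * N" for A B C D N :: real
    using \<tau> by (simp add: field_simps)
  have "1 / (4 * \<tau>) * ((L2_norm \<Omega> (u (n + 1)))\<^sup>2
      + (L2_norm \<Omega> (\<lambda>x. 2 *\<^sub>R u (n + 1) x - u n x))\<^sup>2
      - (L2_norm \<Omega> (u n))\<^sup>2 - (L2_norm \<Omega> (\<lambda>x. 2 *\<^sub>R u n x - u (n - 1) x))\<^sup>2
      + (L2_norm \<Omega> (\<lambda>x. u (n + 1) x - 2 *\<^sub>R u n x + u (n - 1) x))\<^sup>2) =
    - \<nu> * (L2_norm \<Omega> (vgrad (u (n + 1))))\<^sup>2"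
    unfolding domain
  proof (rule bdf2_step_energy_identity[OF \<tau>])
    show "bdf2_step (box a b) \<nu> \<tau> F (f (real (n + 1) * \<tau>)) (u (n - 1)) (u n) (u (n + 1)) (p (n + 1))"
      using bspec[OF bdf2 n] unfolding domain .
    show "f (real (n + 1) * \<tau>) x = 0" if "x \<in> box a b" for x
      using bspec[OF bspec[OF no_force time]] that unfolding domain by simp
    show "face_products_match a b (pd j (u (n + 1))) (u (n + 1))"
      "face_products_match a b (p (n + 1)) (\<lambda>x. u (n + 1) x $ j)" for j
      by (rule face_products_match_solution[OF sides sol[OF range(4)]])+
    show "Ck_closed 1 (box a b) (p (n + 1))"
      using regular[OF range(4)] domain by simp
  qed (use F C2[OF range(1)] C2[OF range(2)] C2[OF range(3)] domain in simp_all)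
  then show "(bdf2_energy \<Omega> u (n + 1) - bdf2_energy \<Omega> u n) / \<tau> =
      - \<nu> * (L2_norm \<Omega> (vgrad (u (n + 1))))\<^sup>2
      - 1 / (4 * \<tau>) * (L2_norm \<Omega> (\<lambda>x. u (n + 1) x - 2 *\<^sub>R u n x + u (n - 1) x))\<^sup>2"
    unfolding bdf2_energy_def
      rearrange[where N = "(L2_norm \<Omega> (\<lambda>x. u (n + 1) x - 2 *\<^sub>R u n x + u (n - 1) x))\<^sup>2"]
    by simp
qed
end
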